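(* Let $K$ be a nonempty compact Hausdorff space and let $W$ be a nonempty subset of $C(K,\mathbb{E}^1)$ such that $Conv(W)$ separates the points of $K$. Then for each $f\in C(K,\mathbb{E}^1)$ there exists $x\in K$ such that $d(f,W)=d_x(f,W)$, that is, $$\inf_{g\in W}\ \sup_{y\in K} d_\infty(f(y),g(y))=\inf_{g\in W} d_\infty(f(x),g(x)).$$
   Context: A fuzzy subset of $\mathbb{R}$ is a function $u:\mathbb{R}\to[0,1]$. Its $\lambda$-level sets are $[u]^\lambda:=\{x\in\mathbb{R}: u(x)\ge\lambda\}$ for $\lambda\in(0,1]$, and $[u]^0$ is the closure of $\{x\in\mathbb{R}:u(x)>0\}$. The fuzzy number space $\mathbb{E}^1$ is the set of all fuzzy subsets $u$ of $\mathbb{R}$ such that: (1) $u$ is normal, i.e. there is $x_0\in\mathbb{R}$ with $u(x_0)=1$; (2) $u$ is convex, i.e. $u(\lambda x+(1-\lambda)y)\ge\min\{u(x),u(y)\}$ for all $x,y\in\mathbb{R}$, $\lambda\in[0,1]$; (3) $u$ is upper semicontinuous; (4) $[u]^0$ is compact. For $u\in\mathbb{E}^1$ and every $\lambda\in[0,1]$ the level set $[u]^\lambda$ is a compact interval, written $[u]^\lambda=[u^-(\lambda),u^+(\lambda)]$. For $u,v\in\mathbb{E}^1$ and $k\in\mathbb{R}$, the sum $u+v$ and the product $ku$ are the fuzzy numbers defined levelwise by interval arithmetic: $[u+v]^\lambda=[u]^\lambda+[v]^\lambda$ and $[ku]^\lambda=k[u]^\lambda$ for all $\lambda\in[0,1]$.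 ($\mathbb{E}^1$ is not a vector space with these operations.) $\mathbb{E}^1$ is equipped with the supremum metric $$d_\infty(u,v):=\sup_{\lambda\in[0,1]}\max\{|u^-(\lambda)-v^-(\lambda)|,\ |u^+(\lambda)-v^+(\lambda)|\}.$$ $C(K,\mathbb{E}^1)$ denotes the set of continuous functions from $K$ to $(\mathbb{E}^1,d_\infty)$, with the metric $D(f,g)=\sup_{t\in K}d_\infty(f(t),g(t))$. $C(K,[0,1])$ denotes the set of continuous functions from $K$ to $[0,1]$. For a nonempty subset $W$ of $C(K,\mathbb{E}^1)$, $$Conv(W):=\{\varphi\in C(K,[0,1]):\ \varphi f+(1-\varphi)g\in W\ \text{for all } f,g\in W\},$$ where $(\varphi f+(1-\varphi)g)(t)=\varphi(t)f(t)+(1-\varphi(t))g(t)$, using the operations on $\mathbb{E}^1$ above. A set $M\subset C(K,[0,1])$ separates the points of $K$ if for any distinct $s,t\in K$ there exists $\phi\in M$ with $\phi(s)\neq\phi(t)$. For $f\in C(K,\mathbb{E}^1)$ and $x\in K$, $$d(f,W):=\inf_{g\in W}\sup_{y\in K}d_\infty(f(y),g(y))=\inf_{g\in W}D(f,g),\qquad d_x(f,W):=\inf_{g\in W}d_\infty(f(x),g(x)).$$ *)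

theory Defs
  imports "HOL-Analysis.Analysis"
begin

section \<open>Fuzzy numbers\<close>

text \<open>Meaningful for \<open>\<alpha> \<in> {0..1}\<close> only.\<close>

definition level_set :: "(real \<Rightarrow> real) \<Rightarrow> real \<Rightarrow> real set" where
  "level_set u \<alpha> = (if \<alpha> = 0 then closure {x. u x > 0} else {x. u x \<ge> \<alpha>})"

definition upper_semicontinuous :: "('a::topological_space \<Rightarrow> real) \<Rightarrow> bool" where
  "upper_semicontinuous u \<longleftrightarrow> (\<forall>x. \<forall>c>u x. eventually (\<lambda>z. u z < c) (nhds x))"

definition is_fuzzy_number :: "(real \<Rightarrow> real) \<Rightarrow> bool" where
  "is_fuzzy_number u \<longleftrightarrow>
     (\<forall>x. u x \<in> {0..1}) \<and>
     (\<exists>x. u x = 1) \<and>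
     (\<forall>x y. \<forall>t\<in>{0..1}. u (t * x + (1 - t) * y) \<ge> min (u x) (u y)) \<and>
     upper_semicontinuous u \<and>
     compact (level_set u 0)"

typedef fuzzy_number = "{u. is_fuzzy_number u}"
  morphisms membership Abs_fuzzy_number
proof -
  let ?u = "\<lambda>x::real. if x = 0 then 1 else 0 :: real"
  have "{x. ?u x > 0} = {0}"
    by auto
  moreover have "eventually (\<lambda>z. ?u z < c) (nhds x)" if "c > ?u x" for x c
  proof (cases "x = 0")
    case True
    with that show ?thesis
      by (auto intro!: always_eventually)
  next
    case False
    then have "eventually (\<lambda>z. z \<in> - {0}) (nhds x)"
      by (intro eventually_nhds_in_open) auto
    then show ?thesis
      by eventually_elim (use that False in auto)
  qed
  ultimately have "is_fuzzy_number ?u"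
    unfolding is_fuzzy_number_def upper_semicontinuous_def level_set_def
    by (auto simp: min_def)
  then show ?thesis
    by blast
qed

definition level :: "fuzzy_number \<Rightarrow> real \<Rightarrow> real set" where
  "level u \<alpha> = level_set (membership u) \<alpha>"

definition lower_end :: "fuzzy_number \<Rightarrow> real \<Rightarrow> real" where
  "lower_end u \<alpha> = Inf (level u \<alpha>)"

definition upper_end :: "fuzzy_number \<Rightarrow> real \<Rightarrow> real" where
  "upper_end u \<alpha> = Sup (level u \<alpha>)"

lemma is_fuzzy_number_membership: "is_fuzzy_number (membership u)"
  using membership by blast

lemma membership_bounds: "0 \<le> membership u x" "membership u x \<le> 1"
  using is_fuzzy_number_membership[of u] by (auto simp: is_fuzzy_number_def)

lemma level_0: "level u 0 = closure {x. membership u x > 0}"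
  by (simp add: level_def level_set_def)

lemma level_pos: "0 < \<alpha> \<Longrightarrow> level u \<alpha> = {x. membership u x \<ge> \<alpha>}"
  by (simp add: level_def level_set_def)

lemma level_nonempty:
  assumes "\<alpha> \<in> {0..1}"
  shows "level u \<alpha> \<noteq> {}"
proof -
  obtain x where x: "membership u x = 1"
    using is_fuzzy_number_membership[of u] by (auto simp: is_fuzzy_number_def)
  show ?thesis
  proof (cases "\<alpha> = 0")
    case True
    have "x \<in> closure {x. membership u x > 0}"
      by (intro subsetD[OF closure_subset]) (simp add: x)
    then show ?thesis
      using True by (metis level_0 empty_iff)
  next
    case False
    then show ?thesis
      using assms x by (auto simp: level_pos intro!: exI[of _ x])
  qed
qed

lemma level_antimono:
  assumes "0 \<le> \<alpha>" "\<alpha> \<le> \<mu>"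
  shows "level u \<mu> \<subseteq> level u \<alpha>"
proof (cases "\<alpha> = 0")
  case True
  show ?thesis
  proof (cases "\<mu> = 0")
    case False
    then have "level u \<mu> \<subseteq> {x. membership u x > 0}"
      using assms by (auto simp: level_pos)
    then show ?thesis
      using True closure_subset by (fastforce simp: level_0)
  qed (use True in auto)
qed (use assms in \<open>auto simp: level_pos\<close>)

lemma closed_level:
  assumes "\<alpha> \<in> {0..1}"
  shows "closed (level u \<alpha>)"
proof (cases "\<alpha> = 0")
  case False
  have usc: "eventually (\<lambda>z. membership u z < \<alpha>) (nhds x)" if "membership u x < \<alpha>" for x
    using is_fuzzy_number_membership[of u] that
    by (auto simp: is_fuzzy_number_def upper_semicontinuous_def)
  have "open {x. membership u x < \<alpha>}"
  proof (rule Topological_Spaces.openI)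
    fix x assume "x \<in> {x. membership u x < \<alpha>}"
    then obtain S where "open S" "x \<in> S" "\<forall>z\<in>S. membership u z < \<alpha>"
      using usc[of x] by (auto simp: eventually_nhds)
    then show "\<exists>T. open T \<and> x \<in> T \<and> T \<subseteq> {x. membership u x < \<alpha>}"
      by blast
  qed
  moreover have "level u \<alpha> = - {x. membership u x < \<alpha>}"
    using False assms by (auto simp: level_pos)
  ultimately show ?thesis
    by (simp add: closed_def)
qed (simp add: level_0)

lemma compact_level:
  assumes "\<alpha> \<in> {0..1}"
  shows "compact (level u \<alpha>)"
proof -
  have "compact (level u 0)"
    using is_fuzzy_number_membership[of u] by (auto simp: is_fuzzy_number_def level_def)
  then have "compact (level u 0 \<inter> level u \<alpha>)"
    using closed_level[OF assms] by (rule compact_Int_closed)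
  moreover have "level u 0 \<inter> level u \<alpha> = level u \<alpha>"
    using level_antimono[of 0 \<alpha> u] assms by auto
  ultimately show ?thesis
    by simp
qed

lemma convex_level:
  assumes "\<alpha> \<in> {0..1}"
  shows "convex (level u \<alpha>)"
proof -
  have quasi: "min (membership u x) (membership u y) \<le> membership u (s * x + t * y)"
    if "0 \<le> s" "0 \<le> t" "s + t = 1" for x y s t
  proof -
    have "t = 1 - s" "s \<in> {0..1}"
      using that by auto
    then show ?thesis
      using is_fuzzy_number_membership[of u] unfolding is_fuzzy_number_def by blast
  qed
  have "convex {x. P (membership u x)}" if "\<And>a b. P a \<Longrightarrow> a \<le> b \<Longrightarrow> P b" for P
  proof (rule convexI)
    fix x y s t :: real
    assume "x \<in> {x. P (membership u x)}" "y \<in> {x. P (membership u x)}"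
      and st: "0 \<le> s" "0 \<le> t" "s + t = 1"
    then have "P (min (membership u x) (membership u y))"
      by (simp add: min_def)
    then show "s *\<^sub>R x + t *\<^sub>R y \<in> {x. P (membership u x)}"
      using that quasi[OF st, of x y] by auto
  qed
  from this[of "\<lambda>a. a > 0"] this[of "\<lambda>a. a \<ge> \<alpha>"]
  have "convex {x. membership u x > 0}" "convex {x. membership u x \<ge> \<alpha>}"
    by auto
  then show ?thesis
    using assms by (cases "\<alpha> = 0") (auto simp: level_0 level_pos intro: convex_closure)
qed

lemma level_eq_interval:
  assumes "\<alpha> \<in> {0..1}"
  shows "level u \<alpha> = {lower_end u \<alpha>..upper_end u \<alpha>}"
proof -
  have "connected (level u \<alpha>)"
    using convex_level[OF assms] by (rule convex_connected)
  then obtain a b where ab: "level u \<alpha> = {a..b}"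
    using connected_compact_interval_1[of "level u \<alpha>"] compact_level[OF assms, of u] by auto
  then have "a \<le> b"
    using level_nonempty[OF assms, of u] by auto
  then show ?thesis
    using ab by (simp add: lower_end_def upper_end_def)
qed

lemma lower_le_upper: "\<alpha> \<in> {0..1} \<Longrightarrow> lower_end u \<alpha> \<le> upper_end u \<alpha>"
  using level_nonempty[of \<alpha> u] level_eq_interval[of \<alpha> u] by auto

lemma fuzzy_number_eqI:
  assumes "\<And>\<alpha>. 0 < \<alpha> \<Longrightarrow> \<alpha> \<le> 1 \<Longrightarrow> level u \<alpha> = level v \<alpha>"
  shows "u = v"
proof -
  have le: "membership u x \<le> membership v x"
    if "\<And>\<alpha>. 0 < \<alpha> \<Longrightarrow> \<alpha> \<le> 1 \<Longrightarrow> level u \<alpha> = level v \<alpha>" for u v x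
  proof (cases "membership u x > 0")
    case True
    then have "x \<in> level u (membership u x)"
      by (simp add: level_pos)
    then have "x \<in> level v (membership u x)"
      using that[OF True] membership_bounds by blast
    then show ?thesis
      using True by (simp add: level_pos)
  next
    case False
    then show ?thesis
      using membership_bounds[of v x] by linarith
  qed
  have "membership u x = membership v x" for x
    by (intro antisym le) (use assms in auto)
  then show ?thesis
    by (auto simp: membership_inject[symmetric])
qed

subsection \<open>Realising a family of intervals as the level sets of a fuzzy number\<close>

lemma fuzzy_number_of_levels:
  fixes A :: "real \<Rightarrow> real set"
  assumes compact: "\<And>\<alpha>. \<alpha> \<in> {0..1} \<Longrightarrow> compact (A \<alpha>)"
    and convex: "\<And>\<alpha>. \<alpha> \<in> {0..1} \<Longrightarrow> convex (A \<alpha>)"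
    and nonempty: "A 1 \<noteq> {}"
    and antimono: "\<And>\<alpha> \<mu>. 0 \<le> \<alpha> \<Longrightarrow> \<alpha> \<le> \<mu> \<Longrightarrow> \<mu> \<le> 1 \<Longrightarrow> A \<mu> \<subseteq> A \<alpha>"
    and left_cont: "\<And>\<alpha> x. 0 < \<alpha> \<Longrightarrow> \<alpha> \<le> 1 \<Longrightarrow> (\<And>\<mu>. 0 < \<mu> \<Longrightarrow> \<mu> < \<alpha> \<Longrightarrow> x \<in> A \<mu>) \<Longrightarrow> x \<in> A \<alpha>"
    and zero: "A 0 \<subseteq> closure (\<Union>\<alpha>\<in>{0<..1}. A \<alpha>)"
  shows "\<exists>!w. \<forall>\<alpha>\<in>{0..1}. level w \<alpha> = A \<alpha>"
proof -
  define S where "S x = insert 0 {\<alpha>\<in>{0<..1}. x \<in> A \<alpha>}" for x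
  define w where "w x = Sup (S x)" for x
  have S: "S x \<noteq> {}" "S x \<subseteq> {0..1}" "bdd_above (S x)" for x
  proof -
    show "S x \<noteq> {}" "S x \<subseteq> {0..1}"
      by (auto simp: S_def)
    then show "bdd_above (S x)"
      by (meson bdd_above_Icc bdd_above_mono)
  qed
  have w01: "0 \<le> w x" "w x \<le> 1" for x
  proof -
    show "0 \<le> w x"
      unfolding w_def using S by (intro cSup_upper) (auto simp: S_def)
    show "w x \<le> 1"
      unfolding w_def using S(1,2) by (intro cSup_least) fastforce+
  qed
  have iff: "\<alpha> \<le> w x \<longleftrightarrow> x \<in> A \<alpha>" if l: "0 < \<alpha>" "\<alpha> \<le> 1" for \<alpha> x
  proof
    assume "x \<in> A \<alpha>"
    then show "\<alpha> \<le> w x"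
      unfolding w_def using S l by (intro cSup_upper) (auto simp: S_def)
  next
    assume le: "\<alpha> \<le> w x"
    show "x \<in> A \<alpha>"
    proof (rule left_cont[OF l])
      fix \<mu> :: real assume m: "0 < \<mu>" "\<mu> < \<alpha>"
      then have "\<mu> < Sup (S x)"
        using le by (simp add: w_def)
      then obtain \<nu> where n: "\<nu> \<in> S x" "\<mu> < \<nu>"
        using less_cSup_iff[OF S(1,3)] by blast
      then have "x \<in> A \<nu>" "\<nu> \<le> 1"
        using m by (auto simp: S_def)
      then show "x \<in> A \<mu>"
        using antimono[of \<mu> \<nu>] m n by auto
    qed
  qed
  have pos: "{x. w x > 0} = (\<Union>\<alpha>\<in>{0<..1}. A \<alpha>)"
  proof (intro set_eqI iffI)
    fix x assume "x \<in> {x. w x > 0}"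
    then show "x \<in> (\<Union>\<alpha>\<in>{0<..1}. A \<alpha>)"
      using iff[of "w x" x] w01[of x] by auto
  next
    fix x assume "x \<in> (\<Union>\<alpha>\<in>{0<..1}. A \<alpha>)"
    then obtain \<alpha> where "0 < \<alpha>" "\<alpha> \<le> 1" "x \<in> A \<alpha>"
      by auto
    then show "x \<in> {x. w x > 0}"
      using iff[of \<alpha> x] by auto
  qed
  have lev: "level_set w \<alpha> = A \<alpha>" if "\<alpha> \<in> {0..1}" for \<alpha>
  proof (cases "\<alpha> = 0")
    case True
    have "(\<Union>\<alpha>\<in>{0<..1}. A \<alpha>) \<subseteq> A 0"
      using antimono[OF order_refl] by (intro UN_least) auto
    then have "closure (\<Union>\<alpha>\<in>{0<..1}. A \<alpha>) \<subseteq> A 0"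
      using compact[of 0] by (intro closure_minimal) (auto intro: compact_imp_closed)
    then show ?thesis
      using True zero pos by (auto simp: level_set_def)
  next
    case False
    then show ?thesis
      using that iff by (auto simp: level_set_def)
  qed
  have usc: "upper_semicontinuous w"
    unfolding upper_semicontinuous_def
  proof (intro allI impI)
    fix x c assume c: "w x < c"
    show "eventually (\<lambda>z. w z < c) (nhds x)"
    proof (cases "c \<le> 1")
      case True
      have c0: "0 < c"
        using c w01[of x] by linarith
      have "closed (A c)"
        using compact[of c] True c0 by (auto intro: compact_imp_closed)
      moreover have "x \<notin> A c"
        using iff[of c x] c True c0 by auto
      ultimately have "eventually (\<lambda>z. z \<in> - A c) (nhds x)"
        by (intro eventually_nhds_in_open) auto
      then show ?thesis
      proof eventually_elim
        case (elim z)
        then show ?case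
          using iff[of c z] True c0 by auto
      qed
    next
      case False
      then show ?thesis
        using w01 by (intro always_eventually allI) (meson le_less_trans not_le)
    qed
  qed
  have quasi: "min (w x) (w y) \<le> w (t * x + (1 - t) * y)" if t: "t \<in> {0..1}" for x y t
  proof (cases "min (w x) (w y) > 0")
    case True
    define m where "m = min (w x) (w y)"
    have m: "0 < m" "m \<le> 1" "m \<le> w x" "m \<le> w y"
      using True w01[of x] by (simp_all add: m_def min_le_iff_disj)
    have "x \<in> A m" "y \<in> A m"
      using m iff[OF m(1,2)] by blast+
    moreover have "convex (A m)"
      using m by (intro convex) simp
    ultimately have "t *\<^sub>R x + (1 - t) *\<^sub>R y \<in> A m"
      using t by (intro convexD) auto
    then have "m \<le> w (t * x + (1 - t) * y)"
      using iff[OF m(1,2), of "t * x + (1 - t) * y"] by simp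
    then show ?thesis
      by (simp only: m_def)
  next
    case False
    then show ?thesis
      using w01[of "t * x + (1 - t) * y"] by linarith
  qed
  obtain x1 where "x1 \<in> A 1"
    using nonempty by auto
  then have "w x1 = 1"
    using iff[of 1 x1] w01[of x1] by auto
  moreover have "compact (level_set w 0)"
    using lev[of 0] compact[of 0] by auto
  ultimately have "is_fuzzy_number w"
    unfolding is_fuzzy_number_def using w01 usc quasi by auto
  then have "membership (Abs_fuzzy_number w) = w"
    by (simp add: Abs_fuzzy_number_inverse)
  then have "\<forall>\<alpha>\<in>{0..1}. level (Abs_fuzzy_number w) \<alpha> = A \<alpha>"
    using lev by (auto simp: level_def)
  then show ?thesis
    by (intro ex1I[of _ "Abs_fuzzy_number w"]) (auto intro: fuzzy_number_eqI)
qed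

lemma level_left_cont:
  assumes "0 < \<alpha>" "\<And>\<mu>. 0 < \<mu> \<Longrightarrow> \<mu> < \<alpha> \<Longrightarrow> x \<in> level u \<mu>"
  shows "x \<in> level u \<alpha>"
proof -
  have "\<mu> \<le> membership u x" if "0 < \<mu>" "\<mu> < \<alpha>" for \<mu>
    using assms(2)[OF that] that by (simp add: level_pos)
  then have "\<alpha> \<le> membership u x"
    using dense_le_bounded[OF assms(1)] by blast
  then show ?thesis
    using assms(1) by (simp add: level_pos)
qed

lemma positive_eq_Union: "{x. membership u x > 0} = (\<Union>\<alpha>\<in>{0<..1}. level u \<alpha>)"
proof (intro set_eqI iffI)
  fix x assume "x \<in> {x. membership u x > 0}"
  then show "x \<in> (\<Union>\<alpha>\<in>{0<..1}. level u \<alpha>)"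
    using membership_bounds[of u x] by (auto simp: level_pos intro!: bexI[of _ "membership u x"])
qed (auto simp: level_pos)

section \<open>Addition and scalar multiplication\<close>

text \<open>Addition of sets is the Minkowski sum.\<close>

instantiation fuzzy_number :: plus
begin

definition plus_fuzzy_number :: "fuzzy_number \<Rightarrow> fuzzy_number \<Rightarrow> fuzzy_number" where
  "u + v = (THE w. \<forall>\<alpha>\<in>{0..1}. level w \<alpha> = level u \<alpha> + level v \<alpha>)"

instance ..

end

text \<open>\<^class>\<open>scaleR\<close> is the purely syntactic class; no vector space laws are claimed.\<close>

instantiation fuzzy_number :: scaleR
begin

definition scaleR_fuzzy_number :: "real \<Rightarrow> fuzzy_number \<Rightarrow> fuzzy_number" where
  "k *\<^sub>R u = (THE w. \<forall>\<alpha>\<in>{0..1}. level w \<alpha> = (\<lambda>x. k * x) ` level u \<alpha>)"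

instance ..

end

lemma level_plus:
  assumes "\<alpha> \<in> {0..1}"
  shows "level (u + v) \<alpha> = level u \<alpha> + level v \<alpha>"
proof -
  have "\<exists>!w. \<forall>\<alpha>\<in>{0..1}. level w \<alpha> = level u \<alpha> + level v \<alpha>"
  proof (rule fuzzy_number_of_levels)
    fix \<alpha> :: real assume l: "\<alpha> \<in> {0..1}"
    have "level u \<alpha> + level v \<alpha> = {x + y | x y. x \<in> level u \<alpha> \<and> y \<in> level v \<alpha>}"
      by (auto simp: set_plus_def)
    then show "compact (level u \<alpha> + level v \<alpha>)"
      using compact_sums[OF compact_level[OF l] compact_level[OF l]] by simp
    show "convex (level u \<alpha> + level v \<alpha>)"
      using l by (intro convex_set_plus convex_level)
  next
    show "level u 1 + level v 1 \<noteq> {}"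
      using level_nonempty[of 1 u] level_nonempty[of 1 v] by (auto simp: set_plus_def)
  next
    fix \<alpha> \<mu> :: real assume "0 \<le> \<alpha>" "\<alpha> \<le> \<mu>" "\<mu> \<le> 1"
    then show "level u \<mu> + level v \<mu> \<subseteq> level u \<alpha> + level v \<alpha>"
      by (intro set_plus_mono2 level_antimono)
  next
    fix \<alpha> z :: real
    assume l: "0 < \<alpha>" "\<alpha> \<le> 1"
      and z: "\<And>\<mu>. 0 < \<mu> \<Longrightarrow> \<mu> < \<alpha> \<Longrightarrow> z \<in> level u \<mu> + level v \<mu>"
    define F where "F \<mu> = level u \<mu> \<inter> (\<lambda>y. z - y) ` level v \<mu>" for \<mu>
    have ne: "F \<mu> \<noteq> {}" if "0 < \<mu>" "\<mu> < \<alpha>" for \<mu>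
    proof -
      obtain x y where "x \<in> level u \<mu>" "y \<in> level v \<mu>" "z = x + y"
        using z[OF \<open>0 < \<mu>\<close> \<open>\<mu> < \<alpha>\<close>] by (auto simp: set_plus_def)
      then have "x \<in> F \<mu>"
        by (auto simp: F_def intro!: image_eqI[of _ _ y])
      then show ?thesis
        by auto
    qed
    have comp: "compact (F \<mu>)" if "0 < \<mu>" "\<mu> < \<alpha>" for \<mu>
      unfolding F_def using that l
      by (intro compact_Int compact_continuous_image compact_level continuous_intros) auto
    have mono: "F \<mu> \<subseteq> F \<nu>" if "0 < \<nu>" "\<nu> \<le> \<mu>" for \<mu> \<nu>
      using level_antimono[of \<nu> \<mu>] that unfolding F_def by (intro Int_mono image_mono) auto
    have chain: "S \<subseteq> T \<or> T \<subseteq> S" if "S \<in> F ` {0<..<\<alpha>} \<and> T \<in> F ` {0<..<\<alpha>}" for S T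
    proof -
      obtain \<mu> \<nu> where "S = F \<mu>" "T = F \<nu>" "0 < \<mu>" "0 < \<nu>"
        using \<open>S \<in> F ` {0<..<\<alpha>} \<and> T \<in> F ` {0<..<\<alpha>}\<close> by auto
      then show ?thesis
        using mono[of \<mu> \<nu>] mono[of \<nu> \<mu>] by (cases "\<mu> \<le> \<nu>") auto
    qed
    have "\<Inter>(F ` {0<..<\<alpha>}) \<noteq> {}"
    proof (rule compact_chain[OF _ _ chain])
      show "{} \<notin> F ` {0<..<\<alpha>}"
        using ne by (auto simp: image_iff) (metis)
    qed (use comp in auto)
    then obtain x where "x \<in> \<Inter>(F ` {0<..<\<alpha>})"
      by blast
    then have x: "x \<in> F \<mu>" if "0 < \<mu>" "\<mu> < \<alpha>" for \<mu>
      using that by auto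
    have "x \<in> level u \<alpha>" "z - x \<in> level v \<alpha>"
      using x unfolding F_def by (intro level_left_cont[OF l(1)]; fastforce)+
    then show "z \<in> level u \<alpha> + level v \<alpha>"
      by (metis set_plus_intro add.commute diff_add_cancel)
  next
    have "level u 0 + level v 0 \<subseteq>
      closure ((\<Union>\<alpha>\<in>{0<..1}. level u \<alpha>) + (\<Union>\<alpha>\<in>{0<..1}. level v \<alpha>))"
      unfolding level_0 positive_eq_Union by (rule closure_sum)
    also have "\<dots> \<subseteq> closure (\<Union>\<alpha>\<in>{0<..1}. level u \<alpha> + level v \<alpha>)"
    proof (rule closure_mono, rule subsetI)
      fix z assume "z \<in> (\<Union>\<alpha>\<in>{0<..1}. level u \<alpha>) + (\<Union>\<alpha>\<in>{0<..1}. level v \<alpha>)"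
      then obtain x y where "x \<in> (\<Union>\<alpha>\<in>{0<..1}. level u \<alpha>)" "y \<in> (\<Union>\<alpha>\<in>{0<..1}. level v \<alpha>)"
        and z: "z = x + y"
        by (rule set_plus_elim)
      then obtain \<alpha> \<mu> where xy: "x \<in> level u \<alpha>" "y \<in> level v \<mu>"
        and lm: "0 < \<alpha>" "\<alpha> \<le> 1" "0 < \<mu>" "\<mu> \<le> 1"
        by auto
      have "x \<in> level u (min \<alpha> \<mu>)" "y \<in> level v (min \<alpha> \<mu>)"
        using xy lm level_antimono[of "min \<alpha> \<mu>" \<alpha> u] level_antimono[of "min \<alpha> \<mu>" \<mu> v] by auto
      then show "z \<in> (\<Union>\<alpha>\<in>{0<..1}. level u \<alpha> + level v \<alpha>)"
        using lm z by (intro UN_I[of "min \<alpha> \<mu>"]) auto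
    qed
    finally show "level u 0 + level v 0 \<subseteq> closure (\<Union>\<alpha>\<in>{0<..1}. level u \<alpha> + level v \<alpha>)" .
  qed
  from theI'[OF this] show ?thesis
    using assms unfolding plus_fuzzy_number_def by blast
qed

lemma level_scaleR:
  assumes "\<alpha> \<in> {0..1}"
  shows "level (k *\<^sub>R u) \<alpha> = (\<lambda>x. k * x) ` level u \<alpha>"
proof -
  have "\<exists>!w. \<forall>\<alpha>\<in>{0..1}. level w \<alpha> = (\<lambda>x. k * x) ` level u \<alpha>"
  proof (rule fuzzy_number_of_levels)
    fix \<alpha> :: real assume l: "\<alpha> \<in> {0..1}"
    show "compact ((\<lambda>x. k * x) ` level u \<alpha>)"
      using l by (intro compact_continuous_image compact_level continuous_intros)
    show "convex ((\<lambda>x. k * x) ` level u \<alpha>)"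
      using convex_scaling[OF convex_level[OF l], of k] by simp
  next
    show "(\<lambda>x. k * x) ` level u 1 \<noteq> {}"
      using level_nonempty[of 1 u] by auto
  next
    fix \<alpha> \<mu> :: real assume "0 \<le> \<alpha>" "\<alpha> \<le> \<mu>" "\<mu> \<le> 1"
    then show "(\<lambda>x. k * x) ` level u \<mu> \<subseteq> (\<lambda>x. k * x) ` level u \<alpha>"
      by (intro image_mono level_antimono)
  next
    fix \<alpha> z :: real
    assume l: "0 < \<alpha>" "\<alpha> \<le> 1"
      and z: "\<And>\<mu>. 0 < \<mu> \<Longrightarrow> \<mu> < \<alpha> \<Longrightarrow> z \<in> (\<lambda>x. k * x) ` level u \<mu>"
    show "z \<in> (\<lambda>x. k * x) ` level u \<alpha>"
    proof (cases "k = 0")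
      case True
      then have "z = 0"
        using z[of "\<alpha> / 2"] l by auto
      then show ?thesis
        using True level_nonempty[of \<alpha> u] l by auto
    next
      case False
      have "z / k \<in> level u \<alpha>"
      proof (rule level_left_cont[OF l(1)])
        fix \<mu> assume "0 < \<mu>" "\<mu> < \<alpha>"
        then show "z / k \<in> level u \<mu>"
          using z[of \<mu>] False by auto
      qed
      then show ?thesis
        using False by (intro image_eqI[of _ _ "z / k"]) auto
    qed
  next
    have "(\<lambda>x. k * x) ` closure (\<Union>\<alpha>\<in>{0<..1}. level u \<alpha>) \<subseteq>
      closure ((\<lambda>x. k * x) ` (\<Union>\<alpha>\<in>{0<..1}. level u \<alpha>))"
      by (intro closure_bounded_linear_image_subset bounded_linear_mult_right)
    then show "(\<lambda>x. k * x) ` level u 0 \<subseteq> closure (\<Union>\<alpha>\<in>{0<..1}. (\<lambda>x. k * x) ` level u \<alpha>)"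
      unfolding level_0 positive_eq_Union image_UN .
  qed
  from theI'[OF this] show ?thesis
    using assms unfolding scaleR_fuzzy_number_def by blast
qed

section \<open>The supremum metric\<close>

definition d_infty :: "fuzzy_number \<Rightarrow> fuzzy_number \<Rightarrow> real" where
  "d_infty u v = (SUP \<alpha>\<in>{0..1}.
     max \<bar>lower_end u \<alpha> - lower_end v \<alpha>\<bar> \<bar>upper_end u \<alpha> - upper_end v \<alpha>\<bar>)"

lemma ends_bounds:
  assumes "\<alpha> \<in> {0..1}"
  shows "lower_end u 0 \<le> lower_end u \<alpha>" "upper_end u \<alpha> \<le> upper_end u 0"
proof -
  have "{lower_end u \<alpha>..upper_end u \<alpha>} \<subseteq> {lower_end u 0..upper_end u 0}"
  proof -
    have "level u \<alpha> \<subseteq> level u 0"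
      using assms by (intro level_antimono) auto
    moreover have "level u 0 = {lower_end u 0..upper_end u 0}"
      by (rule level_eq_interval) simp
    ultimately show ?thesis
      by (simp only: level_eq_interval[OF assms])
  qed
  then show "lower_end u 0 \<le> lower_end u \<alpha>" "upper_end u \<alpha> \<le> upper_end u 0"
    using lower_le_upper[OF assms, of u] by auto
qed

lemma bdd_above_ends:
  "bdd_above ((\<lambda>\<alpha>. max \<bar>lower_end u \<alpha> - lower_end v \<alpha>\<bar> \<bar>upper_end u \<alpha> - upper_end v \<alpha>\<bar>) ` {0..1})"
proof (rule bdd_aboveI2)
  fix \<alpha> :: real assume l: "\<alpha> \<in> {0..1}"
  show "max \<bar>lower_end u \<alpha> - lower_end v \<alpha>\<bar> \<bar>upper_end u \<alpha> - upper_end v \<alpha>\<bar>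
    \<le> max (upper_end u 0 - lower_end v 0) (upper_end v 0 - lower_end u 0)" (is "_ \<le> ?c")
  proof (rule max.boundedI)
    have c: "upper_end u 0 - lower_end v 0 \<le> ?c" "upper_end v 0 - lower_end u 0 \<le> ?c"
      by simp_all
    note bounds = c ends_bounds[OF l, of u] ends_bounds[OF l, of v]
      lower_le_upper[OF l, of u] lower_le_upper[OF l, of v]
    show "\<bar>lower_end u \<alpha> - lower_end v \<alpha>\<bar> \<le> ?c"
      unfolding abs_le_iff using bounds by (intro conjI) linarith+
    show "\<bar>upper_end u \<alpha> - upper_end v \<alpha>\<bar> \<le> ?c"
      unfolding abs_le_iff using bounds by (intro conjI) linarith+
  qed
qed

lemma
  assumes "\<alpha> \<in> {0..1}"
  shows lower_end_dist_le: "\<bar>lower_end u \<alpha> - lower_end v \<alpha>\<bar> \<le> d_infty u v"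
    and upper_end_dist_le: "\<bar>upper_end u \<alpha> - upper_end v \<alpha>\<bar> \<le> d_infty u v"
  using cSUP_upper[OF assms bdd_above_ends[of u v]] by (auto simp: d_infty_def)

lemma d_infty_leI:
  assumes "\<And>\<alpha>. \<alpha> \<in> {0..1} \<Longrightarrow> \<bar>lower_end u \<alpha> - lower_end v \<alpha>\<bar> \<le> c"
    and "\<And>\<alpha>. \<alpha> \<in> {0..1} \<Longrightarrow> \<bar>upper_end u \<alpha> - upper_end v \<alpha>\<bar> \<le> c"
  shows "d_infty u v \<le> c"
  unfolding d_infty_def using assms by (intro cSUP_least) auto

instantiation fuzzy_number :: metric_space
begin

definition dist_fuzzy_number :: "fuzzy_number \<Rightarrow> fuzzy_number \<Rightarrow> real" where
  "dist_fuzzy_number = d_infty"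

definition uniformity_fuzzy_number :: "(fuzzy_number \<times> fuzzy_number) filter" where
  "uniformity_fuzzy_number = (INF e\<in>{0<..}. principal {(u, v). dist u v < e})"

definition open_fuzzy_number :: "fuzzy_number set \<Rightarrow> bool" where
  "open_fuzzy_number U = (\<forall>u\<in>U. eventually (\<lambda>(u', v). u' = u \<longrightarrow> v \<in> U) uniformity)"

instance
proof
  fix u v w :: fuzzy_number
  have eq: "u = v" if "d_infty u v = 0"
  proof (rule fuzzy_number_eqI)
    fix \<alpha> :: real assume "0 < \<alpha>" "\<alpha> \<le> 1"
    then have l: "\<alpha> \<in> {0..1}"
      by auto
    show "level u \<alpha> = level v \<alpha>"
      using lower_end_dist_le[OF l, of u v] upper_end_dist_le[OF l, of u v] that
      by (simp add: level_eq_interval[OF l])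
  qed
  have "d_infty u u = 0" for u :: fuzzy_number
    by (simp add: d_infty_def)
  then show "dist u v = 0 \<longleftrightarrow> u = v"
    using eq by (auto simp: dist_fuzzy_number_def)
  show "dist u v \<le> dist u w + dist v w"
    unfolding dist_fuzzy_number_def
  proof (rule d_infty_leI)
    fix \<alpha> :: real assume l: "\<alpha> \<in> {0..1}"
    show "\<bar>lower_end u \<alpha> - lower_end v \<alpha>\<bar> \<le> d_infty u w + d_infty v w"
      using lower_end_dist_le[OF l, of u w] lower_end_dist_le[OF l, of v w] by linarith
    show "\<bar>upper_end u \<alpha> - upper_end v \<alpha>\<bar> \<le> d_infty u w + d_infty v w"
      using upper_end_dist_le[OF l, of u w] upper_end_dist_le[OF l, of v w] by linarith
  qed
qed (rule uniformity_fuzzy_number_def open_fuzzy_number_def)+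

end

section \<open>Spaces of continuous functions\<close>

text \<open>
  A function on a space \<open>K\<close> is represented by its extension that is \<open>undefined\<close> outside
  \<open>topspace K\<close>, so that equality of functions is equality on \<open>K\<close>.
\<close>

definition continuous_fuzzy :: "'a topology \<Rightarrow> ('a \<Rightarrow> fuzzy_number) set" where
  "continuous_fuzzy K = {f \<in> extensional (topspace K). continuous_map K euclidean f}"

definition continuous_unit :: "'a topology \<Rightarrow> ('a \<Rightarrow> real) set" where
  "continuous_unit K =
     {\<phi> \<in> extensional (topspace K). continuous_map K (top_of_set {0..1}) \<phi>}"

definition Conv :: "'a topology \<Rightarrow> ('a \<Rightarrow> fuzzy_number) set \<Rightarrow> ('a \<Rightarrow> real) set" where
  "Conv K W = {\<phi> \<in> continuous_unit K. \<forall>f\<in>W. \<forall>g\<in>W.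
     (\<lambda>t\<in>topspace K. \<phi> t *\<^sub>R f t + (1 - \<phi> t) *\<^sub>R g t) \<in> W}"

definition separates_points :: "'a topology \<Rightarrow> ('a \<Rightarrow> real) set \<Rightarrow> bool" where
  "separates_points K M \<longleftrightarrow>
     (\<forall>s\<in>topspace K. \<forall>t\<in>topspace K. s \<noteq> t \<longrightarrow> (\<exists>\<phi>\<in>M. \<phi> s \<noteq> \<phi> t))"

end

theory Submission
  imports Defs
begin

text \<open>
  Write \<open>d\<close> for the distance from \<open>f\<close> to \<open>W\<close>. The distance from \<open>f x\<close> to the values at \<open>x\<close> of
  functions in \<open>W\<close> never exceeds \<open>d\<close>, so if the theorem fails it is smaller than \<open>d\<close> at every
  point. Then near every point some member of \<open>W\<close> approximates \<open>f\<close> with an error bounded away from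
  \<open>d\<close>, and it remains to glue finitely many of these local approximations into one member of \<open>W\<close>
  that is closer to \<open>f\<close> than \<open>d\<close> on all of \<open>K\<close>, which is absurd.

  The glue is \<open>Conv K W\<close>. It contains \<open>1\<close> and is closed under \<open>\<phi> \<mapsto> 1 - \<phi>\<close> and under products
  (\<open>Conv_complement\<close>, \<open>Conv_mult\<close>), although \<open>fuzzy_number\<close> is not a vector space: only
  nonnegative coefficients occur, and these distribute over intervals. The functions
  \<open>1 - (1 - \<phi>\<^sup>n)\<^sup>m\<close>, used by Brosowski and Deutsch in their elementary proof of the
  Stone--Weierstrass theorem, sharpen a multiplier \<open>\<phi>\<close> into one that is almost \<open>0\<close> where \<open>\<phi>\<close> is
  small and almost \<open>1\<close> where \<open>\<phi>\<close> is large. With finite products and compactness, a point gets a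
  neighbourhood on which some multiplier is almost \<open>1\<close> while it is almost \<open>0\<close> on a prescribed
  closed set avoiding the point (\<open>exists_sharply_separated_nhd_of_compact\<close>). The neighbourhood
  does not depend on the precision demanded, so a finite subcover can be chosen before the
  precision. Finally the metric is convex in its second argument, so a multiplier that is almost
  an indicator function merges two approximations at an arbitrarily small extra cost
  (\<open>approximable_below_Un\<close>).
\<close>

section \<open>Interval endpoints and convexity of the metric\<close>

lemma lower_end_eqI:
  assumes "x \<in> level u \<alpha>" "\<And>y. y \<in> level u \<alpha> \<Longrightarrow> x \<le> y"
  shows "lower_end u \<alpha> = x"
  unfolding lower_end_def using assms by (rule cInf_eq_minimum)

lemma upper_end_eqI:
  assumes "x \<in> level u \<alpha>" "\<And>y. y \<in> level u \<alpha> \<Longrightarrow> y \<le> x"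
  shows "upper_end u \<alpha> = x"
  unfolding upper_end_def using assms by (rule cSup_eq_maximum)

lemma ends_in_level:
  assumes "\<alpha> \<in> {0..1}"
  shows "lower_end u \<alpha> \<in> level u \<alpha>" "upper_end u \<alpha> \<in> level u \<alpha>"
  using lower_le_upper[OF assms, of u] by (simp_all add: level_eq_interval[OF assms])

lemma ends_plus:
  assumes "\<alpha> \<in> {0..1}"
  shows "lower_end (u + v) \<alpha> = lower_end u \<alpha> + lower_end v \<alpha>"
    and "upper_end (u + v) \<alpha> = upper_end u \<alpha> + upper_end v \<alpha>"
proof -
  have bounds: "lower_end u \<alpha> + lower_end v \<alpha> \<le> z \<and> z \<le> upper_end u \<alpha> + upper_end v \<alpha>"
    if "z \<in> level (u + v) \<alpha>" for z
    using that by (auto simp: level_plus[OF assms] level_eq_interval[OF assms, of u]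
        level_eq_interval[OF assms, of v] elim!: set_plus_elim)
  show "lower_end (u + v) \<alpha> = lower_end u \<alpha> + lower_end v \<alpha>"
    using bounds by (intro lower_end_eqI)
      (auto simp: level_plus[OF assms] intro: set_plus_intro ends_in_level[OF assms])
  show "upper_end (u + v) \<alpha> = upper_end u \<alpha> + upper_end v \<alpha>"
    using bounds by (intro upper_end_eqI)
      (auto simp: level_plus[OF assms] intro: set_plus_intro ends_in_level[OF assms])
qed

lemma ends_scaleR:
  assumes "\<alpha> \<in> {0..1}" "0 \<le> k"
  shows "lower_end (k *\<^sub>R u) \<alpha> = k * lower_end u \<alpha>"
    and "upper_end (k *\<^sub>R u) \<alpha> = k * upper_end u \<alpha>"
proof -
  have bounds: "k * lower_end u \<alpha> \<le> z \<and> z \<le> k * upper_end u \<alpha>" if "z \<in> level (k *\<^sub>R u) \<alpha>" for z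
    using that assms
    by (auto simp: level_scaleR level_eq_interval[of \<alpha> u] intro: mult_left_mono)
  show "lower_end (k *\<^sub>R u) \<alpha> = k * lower_end u \<alpha>"
    using bounds by (intro lower_end_eqI)
      (auto simp: level_scaleR[OF assms(1)] intro: ends_in_level[OF assms(1)])
  show "upper_end (k *\<^sub>R u) \<alpha> = k * upper_end u \<alpha>"
    using bounds by (intro upper_end_eqI)
      (auto simp: level_scaleR[OF assms(1)] intro: ends_in_level[OF assms(1)])
qed

lemma fuzzy_number_eq_endsI:
  assumes "\<And>\<alpha>. \<alpha> \<in> {0..1} \<Longrightarrow> lower_end u \<alpha> = lower_end v \<alpha>"
    and "\<And>\<alpha>. \<alpha> \<in> {0..1} \<Longrightarrow> upper_end u \<alpha> = upper_end v \<alpha>"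
  shows "u = v"
  by (rule fuzzy_number_eqI) (use assms in \<open>simp add: level_eq_interval\<close>)

lemma fuzzy_convex_combination_1: "1 *\<^sub>R u + 0 *\<^sub>R v = (u :: fuzzy_number)"
  by (rule fuzzy_number_eq_endsI) (simp_all add: ends_plus ends_scaleR)

lemma fuzzy_convex_combination_commute:
  assumes "a \<in> {0..1}"
  shows "(1 - a) *\<^sub>R u + a *\<^sub>R v = a *\<^sub>R v + (1 - a) *\<^sub>R (u :: fuzzy_number)"
  by (rule fuzzy_number_eq_endsI) (use assms in \<open>simp_all add: ends_plus ends_scaleR\<close>)

text \<open>
  The scalar \<open>1 - a * b\<close> is the sum of the nonnegative scalars \<open>a * (1 - b)\<close> and \<open>1 - a\<close>, which is
  why the two multiples of \<open>v\<close> on the left combine; for scalars of mixed sign this would fail.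
\<close>

lemma fuzzy_convex_combination_mult:
  assumes "a \<in> {0..1}" "b \<in> {0..1}"
  shows "a *\<^sub>R (b *\<^sub>R u + (1 - b) *\<^sub>R v) + (1 - a) *\<^sub>R v
    = (a * b) *\<^sub>R u + (1 - a * b) *\<^sub>R (v :: fuzzy_number)"
proof -
  have "a * b \<le> 1"
    using assms by (auto intro: mult_le_one)
  then show ?thesis
    using assms
    by (intro fuzzy_number_eq_endsI) (simp_all add: ends_plus ends_scaleR algebra_simps)
qed

text \<open>
  For nonnegative coefficients the endpoints of a combination are the combinations of the
  endpoints, so the estimate reduces to the triangle inequality for real numbers at each level.
\<close>

lemma dist_fuzzy_convex_combination_le:
  fixes u v w :: fuzzy_number
  assumes "a \<in> {0..1}"
  shows "dist u (a *\<^sub>R v + (1 - a) *\<^sub>R w) \<le> a * dist u v + (1 - a) * dist u w"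
proof -
  have le: "\<bar>x - (a * y + (1 - a) * z)\<bar> \<le> a * c + (1 - a) * d"
    if "\<bar>x - y\<bar> \<le> c" "\<bar>x - z\<bar> \<le> d" for x y z c d :: real
  proof -
    have "\<bar>x - (a * y + (1 - a) * z)\<bar> = \<bar>a * (x - y) + (1 - a) * (x - z)\<bar>"
      by (simp add: algebra_simps)
    also have "\<dots> \<le> \<bar>a * (x - y)\<bar> + \<bar>(1 - a) * (x - z)\<bar>"
      by (rule abs_triangle_ineq)
    also have "\<dots> = a * \<bar>x - y\<bar> + (1 - a) * \<bar>x - z\<bar>"
      using assms by (simp add: abs_mult)
    also have "\<dots> \<le> a * c + (1 - a) * d"
      using assms that by (intro add_mono mult_left_mono) auto
    finally show ?thesis .
  qed
  show ?thesis
    unfolding dist_fuzzy_number_def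
    using assms
    by (intro d_infty_leI)
      (simp_all add: ends_plus ends_scaleR le lower_end_dist_le upper_end_dist_le)
qed

section \<open>Multipliers\<close>

lemma Conv_range:
  assumes "\<phi> \<in> Conv K W" "t \<in> topspace K"
  shows "\<phi> t \<in> {0..1}"
  using assms by (auto simp: Conv_def continuous_unit_def continuous_map_in_subtopology)

lemma Conv_continuous:
  assumes "\<phi> \<in> Conv K W"
  shows "continuous_map K euclideanreal \<phi>"
  using assms by (auto simp: Conv_def continuous_unit_def continuous_map_in_subtopology)

lemma ConvD:
  assumes "\<phi> \<in> Conv K W" "f \<in> W" "g \<in> W"
  shows "(\<lambda>t\<in>topspace K. \<phi> t *\<^sub>R f t + (1 - \<phi> t) *\<^sub>R g t) \<in> W"
  using assms by (auto simp: Conv_def)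

lemma restrict_in_ConvI:
  assumes "continuous_map K euclideanreal \<phi>" "\<And>t. t \<in> topspace K \<Longrightarrow> \<phi> t \<in> {0..1}"
    and "\<And>f g. f \<in> W \<Longrightarrow> g \<in> W \<Longrightarrow>
      (\<lambda>t\<in>topspace K. \<phi> t *\<^sub>R f t + (1 - \<phi> t) *\<^sub>R g t) \<in> W"
  shows "restrict \<phi> (topspace K) \<in> Conv K W"
proof -
  have "continuous_map K euclideanreal (restrict \<phi> (topspace K))"
    using assms(1) by (rule continuous_map_eq) simp
  moreover have "(\<lambda>t\<in>topspace K. restrict \<phi> (topspace K) t *\<^sub>R f t
      + (1 - restrict \<phi> (topspace K) t) *\<^sub>R g t)
    = (\<lambda>t\<in>topspace K. \<phi> t *\<^sub>R f t + (1 - \<phi> t) *\<^sub>R g t)" for f g :: "'a \<Rightarrow> fuzzy_number"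
    by (auto simp: restrict_def)
  ultimately show ?thesis
    using assms(2,3)
    by (auto simp: Conv_def continuous_unit_def continuous_map_in_subtopology)
qed

lemma Conv_one:
  assumes "W \<subseteq> continuous_fuzzy K"
  shows "(\<lambda>t\<in>topspace K. 1) \<in> Conv K W"
proof (rule restrict_in_ConvI)
  fix f g assume "f \<in> W" "g \<in> W"
  then have "(\<lambda>t\<in>topspace K. 1 *\<^sub>R f t + (1 - 1) *\<^sub>R g t) = f"
    using assms
    by (auto simp: continuous_fuzzy_def fuzzy_convex_combination_1 extensional_restrict)
  then show "(\<lambda>t\<in>topspace K. 1 *\<^sub>R f t + (1 - 1) *\<^sub>R g t) \<in> W"
    using \<open>f \<in> W\<close> by simp
qed auto

lemma Conv_complement:
  assumes "\<phi> \<in> Conv K W"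
  shows "(\<lambda>t\<in>topspace K. 1 - \<phi> t) \<in> Conv K W"
proof (rule restrict_in_ConvI)
  show "continuous_map K euclideanreal (\<lambda>t. 1 - \<phi> t)"
    by (intro continuous_intros Conv_continuous[OF assms])
next
  fix f g assume fg: "f \<in> W" "g \<in> W"
  have "(\<lambda>t\<in>topspace K. (1 - \<phi> t) *\<^sub>R f t + (1 - (1 - \<phi> t)) *\<^sub>R g t)
    = (\<lambda>t\<in>topspace K. \<phi> t *\<^sub>R g t + (1 - \<phi> t) *\<^sub>R f t)"
    by (rule restrict_ext) (simp add: fuzzy_convex_combination_commute[OF Conv_range[OF assms]])
  then show "(\<lambda>t\<in>topspace K. (1 - \<phi> t) *\<^sub>R f t + (1 - (1 - \<phi> t)) *\<^sub>R g t) \<in> W"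
    using ConvD[OF assms fg(2,1)] by simp
qed (use Conv_range[OF assms] in auto)

text \<open>
  Mixing \<open>f\<close> into \<open>g\<close> with weight \<open>\<psi>\<close>, and the result into \<open>g\<close> with weight \<open>\<phi>\<close>, mixes \<open>f\<close> into
  \<open>g\<close> with weight \<open>\<phi> * \<psi>\<close>.
\<close>

lemma Conv_mult:
  assumes "\<phi> \<in> Conv K W" "\<psi> \<in> Conv K W"
  shows "(\<lambda>t\<in>topspace K. \<phi> t * \<psi> t) \<in> Conv K W"
proof (rule restrict_in_ConvI)
  show "continuous_map K euclideanreal (\<lambda>t. \<phi> t * \<psi> t)"
    by (intro continuous_intros Conv_continuous[OF assms(1)] Conv_continuous[OF assms(2)])
next
  fix f g assume fg: "f \<in> W" "g \<in> W"
  let ?h = "\<lambda>t\<in>topspace K. \<psi> t *\<^sub>R f t + (1 - \<psi> t) *\<^sub>R g t"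
  have "(\<lambda>t\<in>topspace K. (\<phi> t * \<psi> t) *\<^sub>R f t + (1 - \<phi> t * \<psi> t) *\<^sub>R g t)
    = (\<lambda>t\<in>topspace K. \<phi> t *\<^sub>R ?h t + (1 - \<phi> t) *\<^sub>R g t)"
    by (rule restrict_ext)
      (simp add: fuzzy_convex_combination_mult[OF Conv_range[OF assms(1)] Conv_range[OF assms(2)]])
  then show "(\<lambda>t\<in>topspace K. (\<phi> t * \<psi> t) *\<^sub>R f t + (1 - \<phi> t * \<psi> t) *\<^sub>R g t) \<in> W"
    using ConvD[OF assms(1) ConvD[OF assms(2) fg] fg(2)] by simp
qed (use Conv_range[OF assms(1)] Conv_range[OF assms(2)] in \<open>auto intro: mult_le_one\<close>)

lemma Conv_power:
  assumes "W \<subseteq> continuous_fuzzy K" "\<phi> \<in> Conv K W"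
  shows "(\<lambda>t\<in>topspace K. \<phi> t ^ n) \<in> Conv K W"
proof (induction n)
  case 0
  then show ?case
    unfolding power_0 by (rule Conv_one[OF assms(1)])
next
  case (Suc n)
  have eq: "(\<lambda>t\<in>topspace K. \<phi> t ^ Suc n)
    = (\<lambda>t\<in>topspace K. \<phi> t * (\<lambda>t\<in>topspace K. \<phi> t ^ n) t)"
    by (rule restrict_ext) simp
  show ?case
    unfolding eq by (rule Conv_mult[OF assms(2) Suc.IH])
qed

section \<open>Sharp separation by multipliers\<close>

text \<open>
  The function \<open>(1 - u\<^sup>n)\<^sup>m\<close> behaves like \<open>exp (- m * u\<^sup>n)\<close>. Choosing \<open>m\<close> close to \<open>c\<^sup>n\<close> with
  \<open>1/b < c < 1/a\<close> makes the exponent \<open>m * u\<^sup>n\<close> tend to \<open>0\<close> for \<open>u \<le> a\<close> and to infinity for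
  \<open>u \<ge> b\<close> as \<open>n\<close> grows. Bernoulli's inequality makes both halves precise.
\<close>

lemma exists_sharpening_exponents:
  fixes a b \<epsilon> :: real
  assumes "0 < a" "a < b" "b \<le> 1" "0 < \<epsilon>"
  obtains n m :: nat
  where "\<And>u. u \<in> {0..a} \<Longrightarrow> 1 - (1 - u ^ n) ^ m < \<epsilon>"
    and "\<And>u. u \<in> {b..1} \<Longrightarrow> (1 - u ^ n) ^ m < \<epsilon>"
proof -
  obtain c where c: "1 / b < c" "c < 1 / a"
    using assms dense[of "1 / b" "1 / a"] by (auto simp: field_simps)
  then have ca: "0 < c" "c * a < 1" "1 < c * b"
    using assms order_less_trans[of 0 "1 / b" c] by (auto simp: field_simps)
  have "(\<lambda>n. (c * a) ^ n + a ^ n) \<longlonglongrightarrow> 0 + 0"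
    using assms ca by (intro tendsto_add LIMSEQ_realpow_zero) auto
  then have "\<forall>\<^sub>F n in sequentially. (c * a) ^ n + a ^ n < \<epsilon>"
    using assms(4) by (auto dest: order_tendstoD)
  moreover have "\<forall>\<^sub>F n in sequentially. 1 / \<epsilon> < (c * b) ^ n"
    using filterlim_realpow_sequentially_gt1[of "c * b"] ca(3)
    by (auto simp: filterlim_at_top_dense dest!: filterlim_at_infinity_imp_norm_at_top)
  ultimately have "\<forall>\<^sub>F n in sequentially. (c * a) ^ n + a ^ n < \<epsilon> \<and> 1 / \<epsilon> < (c * b) ^ n"
    by (rule eventually_conj)
  then obtain n where n: "(c * a) ^ n + a ^ n < \<epsilon>" "1 / \<epsilon> < (c * b) ^ n"
    by (auto simp: eventually_sequentially)
  define m where "m = nat \<lceil>c ^ n\<rceil>"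
  have m: "c ^ n \<le> real m" "real m \<le> c ^ n + 1"
    using ca(1) by (auto simp: m_def)
  show thesis
  proof
    fix u assume u: "u \<in> {0..a}"
    then have le: "u ^ n \<le> a ^ n" "u ^ n \<le> 1"
      using assms by (auto intro: power_mono power_le_one)
    have "1 - (1 - u ^ n) ^ m \<le> real m * u ^ n"
      using Bernoulli_inequality[of "- (u ^ n)" m] le by simp
    also have "\<dots> \<le> (c ^ n + 1) * a ^ n"
      using m le ca(1) u by (intro mult_mono) auto
    also have "\<dots> < \<epsilon>"
      using n(1) by (simp add: algebra_simps power_mult_distrib)
    finally show "1 - (1 - u ^ n) ^ m < \<epsilon>" .
  next
    fix u assume u: "u \<in> {b..1}"
    then have u0: "0 \<le> u ^ n" "u ^ n \<le> 1" "b ^ n \<le> u ^ n"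
      using assms by (auto intro: power_mono power_le_one)
    have "1 / \<epsilon> < c ^ n * b ^ n"
      using n(2) by (simp add: power_mult_distrib)
    also have "\<dots> \<le> real m * u ^ n"
      using m(1) u0 assms by (intro mult_mono) auto
    also have "\<dots> \<le> (1 + u ^ n) ^ m"
      using Bernoulli_inequality[of "u ^ n" m] u0 by simp
    finally have gt: "1 / \<epsilon> < (1 + u ^ n) ^ m" .
    \<comment> \<open>Bernoulli bounds \<open>(1 + u\<^sup>n)\<^sup>m\<close> from below, and \<open>(1 - u\<^sup>n) * (1 + u\<^sup>n) \<le> 1\<close> turns this
      into an upper bound for \<open>(1 - u\<^sup>n)\<^sup>m\<close>.\<close>
    have "(1 - u ^ n) ^ m * (1 + u ^ n) ^ m \<le> 1"
      using u0 unfolding power_mult_distrib[symmetric]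
      by (intro power_le_one) (auto simp: algebra_simps mult_le_one)
    then have "(1 - u ^ n) ^ m \<le> 1 / (1 + u ^ n) ^ m"
      using u0 by (simp add: pos_le_divide_eq)
    also have "\<dots> < \<epsilon>"
      using gt assms(4) u0 by (simp add: field_simps)
    finally show "(1 - u ^ n) ^ m < \<epsilon>" .
  qed
qed

text \<open>
  The sets \<open>P\<close> and \<open>Q\<close> are fixed before \<open>\<epsilon>\<close>: this uniformity is what survives a finite number of
  products and is needed in the final gluing, where the precision is chosen last.
\<close>

definition sharply_separates :: "('a \<Rightarrow> real) set \<Rightarrow> 'a set \<Rightarrow> 'a set \<Rightarrow> bool" where
  "sharply_separates A P Q \<longleftrightarrow>
     (\<forall>\<epsilon>>0. \<exists>\<psi>\<in>A. (\<forall>t\<in>P. \<psi> t < \<epsilon>) \<and> (\<forall>t\<in>Q. 1 - \<epsilon> < \<psi> t))"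

lemma sharply_separates_mono:
  assumes "sharply_separates A P Q" "P' \<subseteq> P" "Q' \<subseteq> Q"
  shows "sharply_separates A P' Q'"
  using assms unfolding sharply_separates_def by (meson subsetD)

lemma sharply_separates_sublevel_superlevel:
  assumes W: "W \<subseteq> continuous_fuzzy K" and \<phi>: "\<phi> \<in> Conv K W" and "0 < a" "a < b" "b \<le> 1"
  shows "sharply_separates (Conv K W) {t \<in> topspace K. \<phi> t < a} {t \<in> topspace K. b < \<phi> t}"
  unfolding sharply_separates_def
proof (intro allI impI)
  fix \<epsilon> :: real assume "0 < \<epsilon>"
  then obtain n m where nm: "\<And>u. u \<in> {0..a} \<Longrightarrow> 1 - (1 - u ^ n) ^ m < \<epsilon>"
    "\<And>u. u \<in> {b..1} \<Longrightarrow> (1 - u ^ n) ^ m < \<epsilon>"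
    using exists_sharpening_exponents assms(3-5) by metis
  define \<psi> where "\<psi> = (\<lambda>t\<in>topspace K. 1 - (\<lambda>t\<in>topspace K.
    (\<lambda>t\<in>topspace K. 1 - (\<lambda>t\<in>topspace K. \<phi> t ^ n) t) t ^ m) t)"
  have "\<psi> \<in> Conv K W"
    unfolding \<psi>_def by (intro Conv_complement Conv_power W \<phi>)
  moreover have "\<psi> t = 1 - (1 - \<phi> t ^ n) ^ m" if "t \<in> topspace K" for t
    using that by (simp add: \<psi>_def)
  ultimately show "\<exists>\<psi>\<in>Conv K W. (\<forall>t\<in>{t \<in> topspace K. \<phi> t < a}. \<psi> t < \<epsilon>) \<and>
      (\<forall>t\<in>{t \<in> topspace K. b < \<phi> t}. 1 - \<epsilon> < \<psi> t)"
    using nm Conv_range[OF \<phi>] by (intro bexI[of _ \<psi>]) force+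
qed

text \<open>
  The product of two multipliers is small where one of them is small, and almost \<open>1\<close> where both
  are.
\<close>

lemma sharply_separates_Un_Int:
  assumes sep: "sharply_separates (Conv K W) P Q" "sharply_separates (Conv K W) P' Q'"
    and sub: "P \<subseteq> topspace K" "P' \<subseteq> topspace K" "Q \<subseteq> topspace K"
  shows "sharply_separates (Conv K W) (P \<union> P') (Q \<inter> Q')"
  unfolding sharply_separates_def
proof (intro allI impI)
  fix \<epsilon> :: real assume "0 < \<epsilon>"
  then have e: "0 < \<epsilon> / 2"
    by simp
  obtain \<psi> where \<psi>: "\<psi> \<in> Conv K W" "\<forall>t\<in>P. \<psi> t < \<epsilon> / 2" "\<forall>t\<in>Q. 1 - \<epsilon> / 2 < \<psi> t"
    using sep(1) e unfolding sharply_separates_def by blast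
  obtain \<psi>' where \<psi>': "\<psi>' \<in> Conv K W" "\<forall>t\<in>P'. \<psi>' t < \<epsilon> / 2" "\<forall>t\<in>Q'. 1 - \<epsilon> / 2 < \<psi>' t"
    using sep(2) e unfolding sharply_separates_def by blast
  let ?\<chi> = "\<lambda>t\<in>topspace K. \<psi> t * \<psi>' t"
  have "?\<chi> t < \<epsilon>" if "t \<in> P \<union> P'" for t
  proof -
    have t: "t \<in> topspace K"
      using that sub by auto
    have "\<psi> t * \<psi>' t \<le> \<psi> t" "\<psi> t * \<psi>' t \<le> \<psi>' t"
      using Conv_range[OF \<psi>(1) t] Conv_range[OF \<psi>'(1) t]
      by (auto intro: mult_left_le mult_left_le_one_le)
    then show ?thesis
      using that t \<psi>(2) \<psi>'(2) \<open>0 < \<epsilon>\<close> by (auto dest!: bspec)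
  qed
  moreover have "1 - \<epsilon> < ?\<chi> t" if "t \<in> Q \<inter> Q'" for t
  proof -
    have t: "t \<in> topspace K"
      using that sub by auto
    \<comment> \<open>Expanding this product gives \<open>\<psi> * \<psi>' \<ge> \<psi> + \<psi>' - 1\<close>, so the two errors of \<open>\<epsilon>/2\<close> add up.\<close>
    have "0 \<le> (1 - \<psi> t) * (1 - \<psi>' t)"
      using Conv_range[OF \<psi>(1) t] Conv_range[OF \<psi>'(1) t] by auto
    then have "\<psi> t + \<psi>' t - 1 \<le> \<psi> t * \<psi>' t"
      by (simp add: algebra_simps)
    moreover have "1 - \<epsilon> / 2 < \<psi> t" "1 - \<epsilon> / 2 < \<psi>' t"
      using that \<psi>(3) \<psi>'(3) by auto
    ultimately show ?thesis
      using t by simp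
  qed
  ultimately show "\<exists>\<psi>\<in>Conv K W. (\<forall>t\<in>P \<union> P'. \<psi> t < \<epsilon>) \<and> (\<forall>t\<in>Q \<inter> Q'. 1 - \<epsilon> < \<psi> t)"
    using Conv_mult[OF \<psi>(1) \<psi>'(1)] by blast
qed

text \<open>
  A multiplier with \<open>\<phi> s < \<phi> x\<close> exists because one may replace \<open>\<phi>\<close> by \<open>1 - \<phi>\<close>. Two thresholds
  strictly between these values then define the neighbourhoods.
\<close>

lemma exists_sharply_separated_nhds:
  assumes W: "W \<subseteq> continuous_fuzzy K" and sep: "separates_points K (Conv K W)"
    and "s \<in> topspace K" "x \<in> topspace K" "s \<noteq> x"
  obtains P Q where "openin K P" "s \<in> P" "openin K Q" "x \<in> Q"
    "sharply_separates (Conv K W) P Q"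
proof -
  obtain \<phi> where \<phi>: "\<phi> \<in> Conv K W" "\<phi> s < \<phi> x"
  proof -
    obtain \<phi> where \<phi>: "\<phi> \<in> Conv K W" "\<phi> s \<noteq> \<phi> x"
      using sep assms(3-5) unfolding separates_points_def by blast
    show thesis
    proof (cases "\<phi> s < \<phi> x")
      case True
      then show ?thesis
        using that \<phi>(1) by blast
    next
      case False
      then show ?thesis
        using that[OF Conv_complement[OF \<phi>(1)]] \<phi>(2) assms(3,4) by simp
    qed
  qed
  obtain b where b: "\<phi> s < b" "b < \<phi> x"
    using dense[OF \<phi>(2)] by blast
  obtain a where a: "\<phi> s < a" "a < b"
    using dense[OF b(1)] by blast
  have "0 < a" "b \<le> 1"
    using a b Conv_range[OF \<phi>(1)] assms(3,4) by fastforce+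
  have open_lt: "openin K {t \<in> topspace K. \<phi> t < a}"
    using openin_continuous_map_preimage[OF Conv_continuous[OF \<phi>(1)], of "{..<a}"] by simp
  have open_gt: "openin K {t \<in> topspace K. b < \<phi> t}"
    using openin_continuous_map_preimage[OF Conv_continuous[OF \<phi>(1)], of "{b<..}"] by simp
  show thesis
    by (rule that[OF open_lt _ open_gt _ sharply_separates_sublevel_superlevel])
      (use W \<phi> a b \<open>0 < a\<close> \<open>b \<le> 1\<close> assms(3,4) in auto)
qed

text \<open>
  The neighbourhoods of the points of \<open>C\<close> have a finite subcover, and the corresponding
  neighbourhoods of \<open>x\<close> are intersected.
\<close>

lemma exists_sharply_separated_nhd_of_compact:
  assumes W: "W \<subseteq> continuous_fuzzy K" and sep: "separates_points K (Conv K W)"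
    and C: "compactin K C" and x: "x \<in> topspace K" "x \<notin> C"
  obtains Q where "openin K Q" "x \<in> Q" "sharply_separates (Conv K W) C Q"
proof -
  have C_sub: "C \<subseteq> topspace K"
    using C by (rule compactin_subset_topspace)
  define good where "good P \<longleftrightarrow> openin K P \<and>
    (\<exists>Q. openin K Q \<and> x \<in> Q \<and> sharply_separates (Conv K W) P Q)" for P
  have "\<exists>P. good P \<and> s \<in> P" if "s \<in> C" for s
    using exists_sharply_separated_nhds[OF W sep, of s x] that C_sub x
    unfolding good_def by (metis subsetD)
  then have cover: "C \<subseteq> \<Union>{P. good P}"
    by blast
  obtain \<F> where \<F>: "finite \<F>" "\<F> \<subseteq> {P. good P}" "C \<subseteq> \<Union>\<F>"
    using compactinD[OF C _ cover] by (auto simp: good_def)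
  from \<F>(1,2) have "good (\<Union>\<F>)"
  proof (induction \<F>)
    case empty
    have "sharply_separates (Conv K W) {} (topspace K)"
      unfolding sharply_separates_def by (auto intro!: bexI[OF _ Conv_one[OF W]])
    then show ?case
      using x(1) by (auto simp: good_def)
  next
    case (insert P \<F>)
    then obtain Q Q' where "openin K P" "openin K (\<Union>\<F>)" "openin K Q" "x \<in> Q" "openin K Q'" "x \<in> Q'"
      "sharply_separates (Conv K W) P Q" "sharply_separates (Conv K W) (\<Union>\<F>) Q'"
      by (auto simp: good_def)
    then show ?case
      using sharply_separates_Un_Int[of K W P Q "\<Union>\<F>" Q'] unfolding good_def
      by (auto intro!: exI[of _ "Q \<inter> Q'"] dest: openin_subset)
  qed
  then obtain Q where Q: "openin K Q" "x \<in> Q" "sharply_separates (Conv K W) (\<Union>\<F>) Q"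
    by (auto simp: good_def)
  then have "sharply_separates (Conv K W) C Q"
    using sharply_separates_mono[OF _ \<F>(3) order_refl] by blast
  with Q that show thesis
    by blast
qed

section \<open>Gluing local approximations\<close>

lemma continuous_map_dist_fuzzy:
  assumes "f \<in> continuous_fuzzy K" "g \<in> continuous_fuzzy K"
  shows "continuous_map K euclideanreal (\<lambda>t. dist (f t) (g t))"
proof -
  have pair: "continuous_map K euclidean (\<lambda>t. (f t, g t))"
    unfolding prod_topology_euclidean[symmetric]
    using assms by (intro continuous_map_pairedI) (auto simp: continuous_fuzzy_def)
  have "continuous_map euclidean euclideanreal
      (\<lambda>p :: fuzzy_number \<times> fuzzy_number. dist (fst p) (snd p))"
    by (simp add: continuous_on_dist continuous_on_fst continuous_on_snd)
  from continuous_map_compose[OF pair this] show ?thesis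
    by (simp add: o_def)
qed

lemma bdd_above_dist_fuzzy:
  assumes "compact_space K" "f \<in> continuous_fuzzy K" "g \<in> continuous_fuzzy K"
  shows "bdd_above ((\<lambda>t. dist (f t) (g t)) ` topspace K)"
proof -
  have "compact ((\<lambda>t. dist (f t) (g t)) ` topspace K)"
    using image_compactin[OF _ continuous_map_dist_fuzzy[OF assms(2,3)]] assms(1)
    by (simp add: compact_space_def)
  then show ?thesis
    by (intro bounded_imp_bdd_above compact_imp_bounded)
qed

text \<open>
  The bound \<open>r\<close> keeps the error uniformly away from \<open>d\<close> on \<open>S\<close>, leaving room for the small
  losses incurred by gluing.
\<close>

definition approximable_below ::
  "('a \<Rightarrow> fuzzy_number) set \<Rightarrow> ('a \<Rightarrow> fuzzy_number) \<Rightarrow> real \<Rightarrow> 'a set \<Rightarrow> bool" where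
  "approximable_below W f d S \<longleftrightarrow> (\<exists>g\<in>W. \<exists>r<d. \<forall>t\<in>S. dist (f t) (g t) \<le> r)"

text \<open>
  Let \<open>h\<close> approximate \<open>f\<close> on \<open>S\<close> and \<open>g\<close> approximate \<open>f\<close> on \<open>N\<close>, and mix them with weight \<open>\<psi>\<close> on
  \<open>g\<close>, where \<open>\<psi>\<close> is almost \<open>1\<close> on \<open>V\<close> and almost \<open>0\<close> off \<open>N\<close>. On \<open>V\<close> the mixture is almost \<open>g\<close>; on
  \<open>S\<close> off \<open>N\<close> it is almost \<open>h\<close>; on \<open>S \<inter> N\<close>, where \<open>\<psi>\<close> is not controlled, both functions are good
  and so is every convex combination of them.
\<close>

lemma approximable_below_Un:
  assumes K: "compact_space K" and W: "W \<subseteq> continuous_fuzzy K" and f: "f \<in> continuous_fuzzy K"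
    and S: "approximable_below W f d S" "S \<subseteq> topspace K"
    and N: "approximable_below W f d N" "V \<subseteq> N" "N \<subseteq> topspace K"
    and sep: "sharply_separates (Conv K W) (topspace K - N) V"
  shows "approximable_below W f d (S \<union> V)"
proof -
  obtain g r where g: "g \<in> W" "r < d" "\<And>t. t \<in> N \<Longrightarrow> dist (f t) (g t) \<le> r"
    using N(1) by (auto simp: approximable_below_def)
  obtain h r' where h: "h \<in> W" "r' < d" "\<And>t. t \<in> S \<Longrightarrow> dist (f t) (h t) \<le> r'"
    using S(1) by (auto simp: approximable_below_def)
  define s where "s = max r r'"
  have s: "s < d" "r \<le> s" "r' \<le> s"
    using g h by (auto simp: s_def)
  obtain B where B: "\<And>t. t \<in> topspace K \<Longrightarrow> dist (f t) (g t) \<le> B"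
    using bdd_above_dist_fuzzy[OF K f] g(1) W by (fastforce simp: bdd_above_def)
  obtain B' where B': "\<And>t. t \<in> topspace K \<Longrightarrow> dist (f t) (h t) \<le> B'"
    using bdd_above_dist_fuzzy[OF K f] h(1) W by (fastforce simp: bdd_above_def)
  define M where "M = max 1 (max B B')"
  have M: "0 < M" "B \<le> M" "B' \<le> M"
    by (auto simp: M_def)
  \<comment> \<open>The unwanted function contributes at most \<open>\<epsilon> * M\<close>, here half of the gap \<open>d - s\<close>.\<close>
  define \<epsilon> where "\<epsilon> = (d - s) / (2 * M)"
  have \<epsilon>: "0 < \<epsilon>" "s + \<epsilon> * M < d"
    using M s(1) by (auto simp: \<epsilon>_def field_simps)
  obtain \<psi> where \<psi>: "\<psi> \<in> Conv K W" "\<forall>t\<in>topspace K - N. \<psi> t < \<epsilon>" "\<forall>t\<in>V. 1 - \<epsilon> < \<psi> t"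
    using sep \<epsilon>(1) unfolding sharply_separates_def by blast
  let ?k = "\<lambda>t\<in>topspace K. \<psi> t *\<^sub>R g t + (1 - \<psi> t) *\<^sub>R h t"
  have "dist (f t) (?k t) \<le> s + \<epsilon> * M" if t: "t \<in> S \<union> V" for t
  proof -
    have tK: "t \<in> topspace K"
      using t S N by auto
    define p where "p = \<psi> t"
    define x where "x = dist (f t) (g t)"
    define y where "y = dist (f t) (h t)"
    have p: "0 \<le> p" "p \<le> 1"
      using Conv_range[OF \<psi>(1) tK] by (auto simp: p_def)
    have xy: "0 \<le> x" "x \<le> M" "0 \<le> y" "y \<le> M"
      using B[OF tK] B'[OF tK] M by (auto simp: x_def y_def)
    have "0 \<le> \<epsilon> * M"
      using \<epsilon>(1) M(1) by simp
    have "p * x + (1 - p) * y \<le> s + \<epsilon> * M"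
    proof -
      consider (both) "x \<le> s" "y \<le> s" | (V) "x \<le> s" "1 - p \<le> \<epsilon>" | (off) "y \<le> s" "p \<le> \<epsilon>"
      proof -
        have "t \<in> N \<Longrightarrow> x \<le> s" "t \<in> S \<Longrightarrow> y \<le> s"
          using g(3)[of t] h(3)[of t] s(2,3) by (simp_all add: x_def y_def)
        moreover have "t \<in> V \<Longrightarrow> 1 - p \<le> \<epsilon>" "t \<notin> N \<Longrightarrow> p \<le> \<epsilon>"
          using bspec[OF \<psi>(2), of t] bspec[OF \<psi>(3), of t] tK by (simp_all add: p_def)
        ultimately show thesis
          using t N(2) that by blast
      qed
      then show ?thesis
      proof cases
        case both
        then have "p * x + (1 - p) * y \<le> p * s + (1 - p) * s"
          using p by (intro add_mono mult_left_mono) auto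
        then show ?thesis
          using \<open>0 \<le> \<epsilon> * M\<close> by (simp add: algebra_simps)
      next
        case V
        have "p * x \<le> x" "(1 - p) * y \<le> \<epsilon> * M"
          using p xy V(2) \<epsilon>(1) by (simp_all add: mult_left_le_one_le mult_mono)
        then show ?thesis
          using V(1) by linarith
      next
        case off
        have "(1 - p) * y \<le> y" "p * x \<le> \<epsilon> * M"
          using p xy off(2) \<epsilon>(1) by (simp_all add: mult_left_le_one_le mult_mono)
        then show ?thesis
          using off(1) by linarith
      qed
    qed
    moreover have "dist (f t) (?k t) \<le> p * x + (1 - p) * y"
      using dist_fuzzy_convex_combination_le[of p "f t" "g t" "h t"] p tK
      by (simp add: p_def x_def y_def)
    ultimately show ?thesis
      by linarith
  qed
  then have "\<exists>r<d. \<forall>t\<in>S \<union> V. dist (f t) (?k t) \<le> r"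
    using \<epsilon>(2) by (intro exI[of _ "s + \<epsilon> * M"] conjI ballI)
  then show ?thesis
    unfolding approximable_below_def by (rule bexI[OF _ ConvD[OF \<psi>(1) g(1) h(1)]])
qed

theorem theorem3p2:
  fixes K :: "'a topology" and W :: "('a \<Rightarrow> fuzzy_number) set" and f :: "'a \<Rightarrow> fuzzy_number"
  assumes "topspace K \<noteq> {}" and "compact_space K" and "Hausdorff_space K"
    and "W \<subseteq> continuous_fuzzy K" and "W \<noteq> {}"
    and "separates_points K (Conv K W)"
    and "f \<in> continuous_fuzzy K"
  shows "\<exists>x\<in>topspace K.
    (INF g\<in>W. SUP y\<in>topspace K. d_infty (f y) (g y)) = (INF g\<in>W. d_infty (f x) (g x))"
proof (rule ccontr)
  define d where "d = (INF g\<in>W. SUP y\<in>topspace K. dist (f y) (g y))"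
  assume "\<not> ?thesis"
  then have neq: "(INF g\<in>W. dist (f x) (g x)) \<noteq> d" if "x \<in> topspace K" for x
    using that by (auto simp: d_def dist_fuzzy_number_def)
  have le_SUP: "dist (f x) (g x) \<le> (SUP y\<in>topspace K. dist (f y) (g y))"
    if "x \<in> topspace K" "g \<in> W" for x g
    using that assms(2,4,7) by (intro cSUP_upper bdd_above_dist_fuzzy) auto
  obtain x0 where x0: "x0 \<in> topspace K"
    using assms(1) by blast
  have d_le: "d \<le> (SUP y\<in>topspace K. dist (f y) (g y))" if "g \<in> W" for g
    unfolding d_def
  proof (rule cINF_lower[OF _ that], rule bdd_belowI2)
    show "0 \<le> (SUP y\<in>topspace K. dist (f y) (g y))" if "g \<in> W" for g
      using le_SUP[OF x0 that] zero_le_dist order_trans by blast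
  qed
  have bdd_dist: "bdd_below ((\<lambda>g. dist (f x) (g x)) ` W)" for x
    by (rule bdd_belowI2[of _ 0]) simp
  have near: "\<exists>g\<in>W. dist (f x) (g x) < d" if x: "x \<in> topspace K" for x
  proof -
    have "(INF g\<in>W. dist (f x) (g x)) \<le> d"
      unfolding d_def using assms(5) le_SUP[OF x] by (intro cINF_mono bdd_dist) auto
    with neq[OF x] have "(INF g\<in>W. dist (f x) (g x)) < d"
      by simp
    then show ?thesis
      using assms(5) by (simp add: cINF_less_iff[OF _ bdd_dist])
  qed
  \<comment> \<open>The open sets that can be added to the domain of approximation by \<open>approximable_below_Un\<close>.\<close>
  define good where "good V \<longleftrightarrow> openin K V \<and> (\<exists>N. V \<subseteq> N \<and> N \<subseteq> topspace K \<and>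
    approximable_below W f d N \<and> sharply_separates (Conv K W) (topspace K - N) V)" for V
  have "\<exists>V. good V \<and> x \<in> V" if x: "x \<in> topspace K" for x
  proof -
    obtain g where g: "g \<in> W" "dist (f x) (g x) < d"
      using near[OF x] by blast
    then obtain r where r: "dist (f x) (g x) < r" "r < d"
      using dense by blast
    define N where "N = {t \<in> topspace K. dist (f t) (g t) < r}"
    have open_N: "openin K N"
      using openin_continuous_map_preimage[OF continuous_map_dist_fuzzy[OF assms(7)], of g "{..<r}"]
        g(1) assms(4) by (auto simp: N_def)
    have appr: "approximable_below W f d N"
      unfolding approximable_below_def N_def using g(1) r(2) by force
    have "compactin K (topspace K - N)"
      using open_N assms(2) by (auto intro: closedin_compact_space)
    moreover have "x \<in> N"
      using x r(1) by (simp add: N_def)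
    ultimately obtain Q where Q: "openin K Q" "x \<in> Q"
      "sharply_separates (Conv K W) (topspace K - N) Q"
      using exists_sharply_separated_nhd_of_compact[OF assms(4,6) _ x] by blast
    have "good (Q \<inter> N)"
      unfolding good_def using Q(1) open_N appr
        sharply_separates_mono[OF Q(3), of "topspace K - N" "Q \<inter> N"]
      by (auto intro!: exI[of _ N] dest: openin_subset)
    then show ?thesis
      using Q(2) \<open>x \<in> N\<close> by blast
  qed
  then have cover: "topspace K \<subseteq> \<Union>{V. good V}"
    by blast
  obtain \<F> where \<F>: "finite \<F>" "\<F> \<subseteq> {V. good V}" "topspace K \<subseteq> \<Union>\<F>"
    using compactinD[OF assms(2)[unfolded compact_space_def] _ cover] by (auto simp: good_def)
  from \<F>(1,2) have "approximable_below W f d (\<Union>\<F>) \<and> \<Union>\<F> \<subseteq> topspace K"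
  proof (induction \<F>)
    case empty
    then show ?case
      using near[OF x0] by (auto simp: approximable_below_def)
  next
    case (insert V \<F>)
    then obtain N where N: "openin K V" "V \<subseteq> N" "N \<subseteq> topspace K" "approximable_below W f d N"
      "sharply_separates (Conv K W) (topspace K - N) V"
      by (auto simp: good_def)
    have "approximable_below W f d (\<Union>\<F> \<union> V)"
      using insert N by (intro approximable_below_Un[OF assms(2,4,7)]) auto
    then show ?case
      using N insert by (auto simp: Un_commute)
  qed
  then have "approximable_below W f d (topspace K)"
    using \<F>(3) by (metis subset_antisym)
  then obtain g r where g: "g \<in> W" "r < d" "\<And>t. t \<in> topspace K \<Longrightarrow> dist (f t) (g t) \<le> r"
    by (auto simp: approximable_below_def)
  have "(SUP y\<in>topspace K. dist (f y) (g y)) \<le> r"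
    using assms(1) g(3) by (intro cSUP_least) auto
  with d_le[OF g(1)] g(2) show False
    by simp
qed

end
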